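(* If $G$ is a connected graph of order $n$ that is not a path, then $\alpha_h(G)\le 2n-5$.
   Context: Graphs are finite and simple; $d$ is graph distance and $e(v)$ is the eccentricity of $v$. The one-vertex graph and $K_2$ are paths. A broadcast on a nontrivial connected graph $G=(V,E)$ is a function $f:V\to\{0,1,\dots,\operatorname{diam}(G)\}$ with $f(v)\le e(v)$ for all $v\in V$. Its weight is $\sigma(f)=\sum_{v\in V}f(v)$. Let $V_f^+=\{v\in V: f(v)>0\}$. A vertex $u$ hears $f$ from $v\in V_f^+$ if $d(u,v)\le f(v)$. A broadcast $f$ is h-independent (hearing independent) if no vertex $u\in V_f^+$ hears $f$ from any other vertex $v\in V_f^+$. $\alpha_h(G)$ is the maximum weight of an h-independent broadcast on $G$. *)

theory Defs
  imports "Graph_Theory.Graph_Theory"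
begin

text \<open>
  Finite simple graphs are rendered by the locale \<open>pair_graph\<close>: finite, loop-free, symmetric
  sets of arcs given as ordered pairs of vertices, so an edge between \<open>u\<close> and \<open>v\<close> is the pair of arcs
  \<open>(u, v)\<close> and \<open>(v, u)\<close>.
\<close>

definition path_graph :: "nat \<Rightarrow> nat pair_pre_digraph" where
  "path_graph n = \<lparr> pverts = {..<n}, parcs = {(i, j). i < n \<and> j < n \<and> (j = Suc i \<or> i = Suc j)} \<rparr>"

definition is_path :: "'a pair_pre_digraph \<Rightarrow> bool" where
  "is_path G \<longleftrightarrow> (\<exists>n\<ge>1. digraph_iso (with_proj G) (with_proj (path_graph n)))"

text \<open>
  The \<open>Least\<close> and \<open>Max\<close> expressions below are meaningful for connected finite graphs and for
  vertices of the graph; see \<open>graph_dist_eq_\<mu>\<close>, \<open>finite_h_independent_weights\<close> and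
  \<open>h_independent_weights_nonempty\<close>.
\<close>

definition graph_dist :: "'a pair_pre_digraph \<Rightarrow> 'a \<Rightarrow> 'a \<Rightarrow> nat" where
  "graph_dist G u v = (LEAST k. \<exists>p. pre_digraph.awalk (with_proj G) u p v \<and> length p = k)"

definition eccentricity :: "'a pair_pre_digraph \<Rightarrow> 'a \<Rightarrow> nat" where
  "eccentricity G v = Max (graph_dist G v ` pverts G)"

definition diam :: "'a pair_pre_digraph \<Rightarrow> nat" where
  "diam G = Max (eccentricity G ` pverts G)"

text \<open>
  A broadcast is a HOL function on the whole vertex type; all notions below only look at its
  values on the vertices of the graph.
\<close>

definition broadcast :: "'a pair_pre_digraph \<Rightarrow> ('a \<Rightarrow> nat) \<Rightarrow> bool" where
  "broadcast G f \<longleftrightarrow> f \<in> pverts G \<rightarrow> {0..diam G} \<and> (\<forall>v\<in>pverts G. f v \<le> eccentricity G v)"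

definition weight :: "'a pair_pre_digraph \<Rightarrow> ('a \<Rightarrow> nat) \<Rightarrow> nat" where
  "weight G f = (\<Sum>v\<in>pverts G. f v)"

definition broadcasting :: "'a pair_pre_digraph \<Rightarrow> ('a \<Rightarrow> nat) \<Rightarrow> 'a set" where
  "broadcasting G f = {v \<in> pverts G. f v > 0}"

definition hears :: "'a pair_pre_digraph \<Rightarrow> ('a \<Rightarrow> nat) \<Rightarrow> 'a \<Rightarrow> 'a \<Rightarrow> bool" where
  "hears G f u v \<longleftrightarrow> u \<in> pverts G \<and> v \<in> broadcasting G f \<and> graph_dist G u v \<le> f v"

definition h_independent :: "'a pair_pre_digraph \<Rightarrow> ('a \<Rightarrow> nat) \<Rightarrow> bool" where
  "h_independent G f \<longleftrightarrow>
     (\<forall>u\<in>broadcasting G f. \<not> (\<exists>v\<in>broadcasting G f. v \<noteq> u \<and> hears G f u v))"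

definition alpha_h :: "'a pair_pre_digraph \<Rightarrow> nat" where
  "alpha_h G = Max {weight G f | f. broadcast G f \<and> h_independent G f}"


lemma pair_graph_path_graph: "pair_graph (path_graph n)"
proof -
  have "parcs (path_graph n) \<subseteq> {..<n} \<times> {..<n}"
    by (auto simp: path_graph_def)
  then have "finite (parcs (path_graph n))"
    by (rule finite_subset) simp
  then show ?thesis
    by unfold_locales (auto simp: path_graph_def symmetric_def sym_def)
qed

lemma is_path_iff:
  assumes "pair_graph G"
  shows "is_path G \<longleftrightarrow> (\<exists>n\<ge>1. \<exists>h. bij_betw h (pverts G) {..<n} \<and>
    (\<forall>u\<in>pverts G. \<forall>v\<in>pverts G. (u, v) \<in> parcs G \<longleftrightarrow> h u = Suc (h v) \<or> h v = Suc (h u)))"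
    (is "_ \<longleftrightarrow> ?R")
proof
  interpret pair_graph G by fact
  assume "is_path G"
  then obtain n f where n: "n \<ge> 1" and f: "digraph_isomorphism f"
    and eq: "with_proj (path_graph n) = app_iso f (with_proj G)"
    by (auto simp: is_path_def digraph_iso_def)
  let ?h = "iso_verts f"
  have V: "?h ` pverts G = {..<n}" using arg_cong[OF eq, of verts] by (simp add: path_graph_def)
  have A: "iso_arcs f ` parcs G = parcs (path_graph n)" using arg_cong[OF eq, of arcs] by simp
  have t: "iso_tail f = fst" and h: "iso_head f = snd"
    using arg_cong[OF eq, of tail] arg_cong[OF eq, of head] by simp_all
  have inj: "inj_on ?h (pverts G)" using f by (simp add: digraph_isomorphism_def)
  have arc: "iso_arcs f a = (?h (fst a), ?h (snd a))" if "a \<in> parcs G" for a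
    using f that t h by (auto simp: digraph_isomorphism_def prod_eq_iff)
  have "(u, v) \<in> parcs G \<longleftrightarrow> ?h u = Suc (?h v) \<or> ?h v = Suc (?h u)"
    if uv: "u \<in> pverts G" "v \<in> pverts G" for u v
  proof -
    have lt: "?h u < n" "?h v < n" using V uv by auto
    have "(u, v) \<in> parcs G \<longleftrightarrow> (?h u, ?h v) \<in> iso_arcs f ` parcs G"
    proof
      assume "(?h u, ?h v) \<in> iso_arcs f ` parcs G"
      then obtain a where a: "a \<in> parcs G" "(?h u, ?h v) = iso_arcs f a" by auto
      then have "?h u = ?h (fst a)" "?h v = ?h (snd a)" using arc by auto
      then have "u = fst a" "v = snd a"
        using inj uv a(1) arc_fst_in_verts arc_snd_in_verts by (auto dest: inj_onD)
      then show "(u, v) \<in> parcs G" using a by simp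
    qed (use arc in force)
    then show ?thesis using A lt by (auto simp: path_graph_def)
  qed
  then show ?R using n V inj by (intro exI[of _ n] conjI exI[of _ ?h]) (auto simp: bij_betw_def)
next
  interpret pair_graph G by fact
  assume ?R
  then obtain n h where n: "n \<ge> 1" and b: "bij_betw h (pverts G) {..<n}"
    and E: "\<And>u v. u \<in> pverts G \<Longrightarrow> v \<in> pverts G \<Longrightarrow>
      (u, v) \<in> parcs G \<longleftrightarrow> h u = Suc (h v) \<or> h v = Suc (h u)" by metis
  let ?f = "\<lparr> iso_verts = h, iso_arcs = (\<lambda>(u, v). (h u, h v)), iso_head = snd, iso_tail = fst \<rparr>"
  have inj: "inj_on h (pverts G)" and V: "h ` pverts G = {..<n}" using b by (auto simp: bij_betw_def)
  have "digraph_isomorphism ?f"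
    using inj wf_digraph
    by (auto simp: digraph_isomorphism_def inj_on_def dest: in_arcsD1 in_arcsD2)
  moreover have "(\<lambda>(u, v). (h u, h v)) ` parcs G = parcs (path_graph n)"
  proof (intro equalityI subsetI)
    fix x assume "x \<in> (\<lambda>(u, v). (h u, h v)) ` parcs G"
    then obtain u v where *: "(u, v) \<in> parcs G" "x = (h u, h v)" by auto
    then have "u \<in> pverts G" "v \<in> pverts G" using in_arcsD1 in_arcsD2 by auto
    then show "x \<in> parcs (path_graph n)" using * E V by (auto simp: path_graph_def)
  next
    fix x assume "x \<in> parcs (path_graph n)"
    then obtain i j where x: "x = (i, j)" "i < n" "j < n" "j = Suc i \<or> i = Suc j"
      by (auto simp: path_graph_def)
    then obtain u v where "u \<in> pverts G" "v \<in> pverts G" "i = h u" "j = h v" using V by blast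
    then show "x \<in> (\<lambda>(u, v). (h u, h v)) ` parcs G" using x E by force
  qed
  then have "with_proj (path_graph n) = app_iso ?f (with_proj G)"
    using V by (auto simp: with_proj_def app_iso_def path_graph_def)
  ultimately show "is_path G" using n unfolding is_path_def digraph_iso_def by blast
qed

lemma graph_dist_eq_\<mu>:
  assumes "pair_graph G" "connected (with_proj G)" "u \<in> pverts G" "v \<in> pverts G"
  shows "wf_digraph.\<mu> (with_proj G) (\<lambda>_. 1) u v = ereal (graph_dist G u v)"
proof -
  interpret pair_graph G by fact
  have cost: "awalk_cost (\<lambda>_. 1) p = real (length p)" for p :: "('a \<times> 'a) list"
    by (induction p) auto
  have "strongly_connected (with_proj G)"
    using assms(2) sym_arcs by (intro symmetric_connected_imp_strongly_connected)
  then have "u \<rightarrow>\<^sup>*\<^bsub>with_proj G\<^esub> v"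
    using assms(3,4) by (auto simp: strongly_connected_def)
  then have ex: "\<exists>k p. awalk u p v \<and> length p = k"
    by (auto simp: reachable_awalk)
  obtain p where p: "awalk u p v" "length p = graph_dist G u v"
    using LeastI_ex[OF ex] unfolding graph_dist_def by auto
  have least: "graph_dist G u v \<le> length q" if "awalk u q v" for q
    unfolding graph_dist_def by (rule Least_le) (use that in auto)
  show ?thesis
    unfolding \<mu>_def cost
    by (rule antisym) (use p least in \<open>auto intro!: INF_lower2[of p] INF_greatest\<close>)
qed

lemma finite_h_independent_weights:
  assumes "finite (pverts G)"
  shows "finite {weight G f | f. broadcast G f \<and> h_independent G f}"
proof (rule finite_subset)
  show "{weight G f | f. broadcast G f \<and> h_independent G f} \<subseteq> {.. card (pverts G) * diam G}"
    by (auto simp: weight_def broadcast_def Pi_iff intro!: sum_bounded_above[of _ _ "diam G", simplified])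
qed simp

lemma h_independent_weights_nonempty:
  "{weight G f | f. broadcast G f \<and> h_independent G f} \<noteq> {}"
proof -
  have "broadcast G (\<lambda>_. 0) \<and> h_independent G (\<lambda>_. 0)"
    by (auto simp: broadcast_def h_independent_def broadcasting_def)
  then show ?thesis by blast
qed

end

theory Submission
  imports Defs
begin

text \<open>
  Inserting the vertices one by one next to a neighbour produces a closed tour through all vertices
  of length at most \<open>2(n - 1)\<close>. By the triangle inequality, shortcutting it to the \<open>k\<close> broadcasting
  vertices does not lengthen it, and if \<open>k \<ge> 2\<close>, then each step into \<open>v\<close> has length at least
  \<open>f v + 1\<close>. Hence the weight is at most \<open>2(n - 1) - k\<close>, which settles \<open>k \<ge> 3\<close>. For \<open>k \<le> 2\<close> the weight
  is at most \<open>max (n - 2) (2(n - 3))\<close>, because a distance \<open>n - 1\<close> between two vertices would leave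
  exactly one vertex at each distance from the first one and thus force the graph to be a path.
\<close>

text \<open>Tours are open: a closed one is written with its first vertex repeated at the
  end.\<close>

fun tour_length :: "('a \<Rightarrow> 'a \<Rightarrow> nat) \<Rightarrow> 'a list \<Rightarrow> nat" where
  "tour_length d (x # y # zs) = d x y + tour_length d (y # zs)"
| "tour_length d _ = 0"

lemma tour_length_append:
  "xs \<noteq> [] \<Longrightarrow> ys \<noteq> [] \<Longrightarrow>
    tour_length d (xs @ ys) = tour_length d xs + d (last xs) (hd ys) + tour_length d ys"
proof (induction d xs rule: tour_length.induct)
  case ("2_2" d x)
  then show ?case by (cases ys) auto
qed auto

text \<open>Each step pays for the vertex it enters. The first vertex \<open>x\<close> is never
  entered, so \<open>g x\<close> is missing on the left; a closing step has to supply it.\<close>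

lemma sum_list_le_tour_length:
  assumes "distinct (x # ys)"
    and "\<And>u v. u \<in> set (x # ys) \<Longrightarrow> v \<in> set (x # ys) \<Longrightarrow> u \<noteq> v \<Longrightarrow> g v \<le> d u v"
  shows "sum_list (map g ys) \<le> tour_length d (x # ys)"
  using assms
proof (induction ys arbitrary: x)
  case (Cons y ys)
  have "sum_list (map g ys) \<le> tour_length d (y # ys)" using Cons.prems by (intro Cons.IH) auto
  moreover have "g y \<le> d x y" using Cons.prems by auto
  ultimately show ?case by simp
qed simp

locale connected_pair_graph = pair_graph G for G :: "'a pair_pre_digraph" +
  assumes connected_G: "connected (with_proj G)"
begin

lemma awalk_graph_dist:
  assumes "u \<in> pverts G" "v \<in> pverts G"
  obtains p where "awalk u p v" "length p = graph_dist G u v"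
proof -
  have "strongly_connected (with_proj G)"
    using connected_G sym_arcs by (intro symmetric_connected_imp_strongly_connected)
  then have "u \<rightarrow>\<^sup>*\<^bsub>with_proj G\<^esub> v"
    using assms by (auto simp: strongly_connected_def)
  then have "\<exists>k p. awalk u p v \<and> length p = k"
    by (auto simp: reachable_awalk)
  from LeastI_ex[OF this] that show ?thesis unfolding graph_dist_def by auto
qed

lemma graph_dist_le: "awalk u p v \<Longrightarrow> graph_dist G u v \<le> length p"
  unfolding graph_dist_def by (rule Least_le) auto

lemma graph_dist_triangle:
  assumes "u \<in> pverts G" "v \<in> pverts G" "w \<in> pverts G"
  shows "graph_dist G u w \<le> graph_dist G u v + graph_dist G v w"
proof -
  obtain p q where "awalk u p v" "length p = graph_dist G u v"
    "awalk v q w" "length q = graph_dist G v w"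
    using assms awalk_graph_dist by metis
  then show ?thesis using graph_dist_le[of u "p @ q" w] by simp
qed

lemma graph_dist_self: "u \<in> pverts G \<Longrightarrow> graph_dist G u u = 0"
  using graph_dist_le[of u "[]" u] by (simp add: awalk_Nil_iff)

lemma graph_dist_eq_0:
  assumes "u \<in> pverts G" "v \<in> pverts G" "graph_dist G u v = 0"
  shows "u = v"
  using awalk_graph_dist[OF assms(1,2)] assms(3) by (auto simp: awalk_Nil_iff)

lemma graph_dist_arc: "(u, v) \<in> parcs G \<Longrightarrow> graph_dist G u v \<le> 1"
  using graph_dist_le[of u "[(u, v)]" v] by (auto simp: awalk_simps dest: in_arcsD1 in_arcsD2)

text \<open>Take the tail of the last arc of a shortest walk. Cutting off that arc bounds its
  distance from above, the triangle inequality from below.\<close>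

lemma graph_dist_pred:
  assumes "u \<in> pverts G" "v \<in> pverts G" "graph_dist G u v = Suc k"
  obtains w where "w \<in> pverts G" "(w, v) \<in> parcs G" "graph_dist G u w = k"
proof -
  obtain p where p: "awalk u p v" "length p = Suc k"
    using awalk_graph_dist assms by metis
  then obtain q a where qa: "p = q @ [a]" "length q = k" by (metis length_Suc_conv_rev)
  obtain w where w: "awalk u q w" "awalk w [a] v" using p(1) qa by auto
  then have a: "(w, v) \<in> parcs G" "w \<in> pverts G" by (auto simp: awalk_simps)
  have "graph_dist G u w \<le> k" using w qa graph_dist_le by auto
  moreover have "Suc k \<le> graph_dist G u w + 1"
    using graph_dist_triangle[of u w v] graph_dist_arc[OF a(1)] assms a by simp
  ultimately show ?thesis using that a by force
qed

text \<open>The distance from \<open>u\<close> serves as the isomorphism onto the path. Descending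
  from \<open>v\<close> by predecessors hits every distance, and there are too few vertices to hit
  one twice.\<close>

lemma is_path_if_graph_dist_ge:
  assumes u: "u \<in> pverts G" and v: "v \<in> pverts G" and ge: "card (pverts G) \<le> Suc (graph_dist G u v)"
  shows "is_path G"
proof -
  let ?h = "graph_dist G u" and ?n = "card (pverts G)"
  have down: "i \<in> ?h ` pverts G" if "w \<in> pverts G" "i \<le> ?h w" for i w
    using that
  proof (induction "?h w - i" arbitrary: w)
    case 0
    then show ?case by auto
  next
    case (Suc m)
    then obtain k where k: "?h w = Suc k" by (cases "?h w") auto
    obtain w' where "w' \<in> pverts G" "?h w' = k" using graph_dist_pred[OF u Suc.prems(1) k] .
    then show ?case using Suc k by (intro Suc.hyps(1)[of w']) auto
  qed
  then have sub: "{..<?n} \<subseteq> ?h ` pverts G" using ge v by fastforce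
  have fin: "finite (pverts G)" by simp
  have img: "?h ` pverts G = {..<?n}"
    using card_seteq[OF finite_imageI[OF fin] sub] card_image_le[OF fin, of ?h] by simp
  then have inj: "inj_on ?h (pverts G)" using eq_card_imp_inj_on[OF fin, of ?h] by simp
  \<comment> \<open>The predecessor of \<open>y\<close> on a shortest walk lies on the level of
    \<open>x\<close>, so injectivity identifies it with \<open>x\<close>.\<close>
  have arc: "(x, y) \<in> parcs G"
    if xy: "x \<in> pverts G" "y \<in> pverts G" "?h y = Suc (?h x)" for x y
  proof -
    obtain w where "w \<in> pverts G" "(w, y) \<in> parcs G" "?h w = ?h x"
      using graph_dist_pred[OF u xy(2,3)] .
    then show ?thesis using inj_onD[OF inj, of w x] xy by auto
  qed
  have sym: "(y, x) \<in> parcs G" if "(x, y) \<in> parcs G" for x y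
    using that arcs_symmetric by blast
  have iff: "(x, y) \<in> parcs G \<longleftrightarrow> ?h x = Suc (?h y) \<or> ?h y = Suc (?h x)"
    if xy: "x \<in> pverts G" "y \<in> pverts G" for x y
  proof
    assume a: "(x, y) \<in> parcs G"
    have "?h y \<le> ?h x + 1" "?h x \<le> ?h y + 1"
      using graph_dist_triangle[OF u xy] graph_dist_triangle[OF u xy(2,1)]
        graph_dist_arc[OF a] graph_dist_arc[OF sym[OF a]] by linarith+
    moreover have "?h x \<noteq> ?h y"
      using inj_onD[OF inj, of x y] xy pair_no_loops[OF a] by auto
    ultimately show "?h x = Suc (?h y) \<or> ?h y = Suc (?h x)" by linarith
  qed (use arc sym xy in blast)
  have "?n \<ge> 1" using u by (simp add: Suc_le_eq card_gt_0_iff) blast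
  moreover have "bij_betw ?h (pverts G) {..<?n}" using inj img by (simp add: bij_betw_def)
  ultimately show ?thesis
    unfolding is_path_iff[OF pair_graph_axioms] using iff by blast
qed

text \<open>The detour from \<open>x\<close> to \<open>y\<close> and back to \<open>x\<close> costs
  at most 2, and going from \<open>y\<close> straight to the next vertex is no longer than returning
  to \<open>x\<close> first.\<close>

lemma tour_length_insert:
  assumes "(x, y) \<in> parcs G" "cs \<noteq> []" "set cs \<subseteq> pverts G"
  shows "tour_length (graph_dist G) (as @ x # y # cs) \<le> tour_length (graph_dist G) (as @ x # cs) + 2"
proof -
  have "(y, x) \<in> parcs G" using assms arcs_symmetric by blast
  then have "graph_dist G x y \<le> 1" "graph_dist G y x \<le> 1" "x \<in> pverts G" "y \<in> pverts G"
    using assms graph_dist_arc in_arcsD1 in_arcsD2 by auto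
  moreover obtain c cs' where "cs = c # cs'" using assms by (cases cs) auto
  ultimately have "tour_length (graph_dist G) (x # y # cs) \<le> tour_length (graph_dist G) (x # cs) + 2"
    using assms graph_dist_triangle[of y x c] by auto
  then show ?thesis
    using tour_length_append[of as "x # y # cs"] tour_length_append[of as "x # cs"]
    by (cases "as = []") auto
qed

lemma tour_length_filter:
  assumes "set (x # ys) \<subseteq> pverts G"
  shows "tour_length (graph_dist G) (x # filter P ys) \<le> tour_length (graph_dist G) (x # ys)"
  using assms
proof (induction ys arbitrary: x)
  case (Cons y ys)
  show ?case
  proof (cases "P y")
    case True
    then show ?thesis using Cons by auto
  next
    case False
    have "tour_length (graph_dist G) (x # ys) \<le> graph_dist G x y + tour_length (graph_dist G) (y # ys)"
      using Cons.prems graph_dist_triangle[of x y] by (cases ys) (auto simp: add.assoc[symmetric])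
    then show ?thesis using False Cons.IH[of x] Cons.prems by auto
  qed
qed simp

lemma closed_tour_of_card:
  assumes "v \<in> pverts G" "m < card (pverts G)"
  shows "\<exists>zs. distinct (v # zs) \<and> set (v # zs) \<subseteq> pverts G \<and> length zs = m \<and>
    tour_length (graph_dist G) (v # zs @ [v]) \<le> 2 * m"
  using assms(2)
proof (induction m)
  case 0
  then show ?case using assms by (auto simp: graph_dist_self)
next
  case (Suc m)
  then obtain zs where zs: "distinct (v # zs)" "set (v # zs) \<subseteq> pverts G" "length zs = m"
    "tour_length (graph_dist G) (v # zs @ [v]) \<le> 2 * m" by auto
  let ?S = "set (v # zs)"
  have "card ?S = Suc m" using distinct_card[OF zs(1)] zs(3) by simp
  then have "pverts G \<noteq> ?S" using Suc.prems by auto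
  then obtain z where "z \<in> pverts G - ?S" using zs(2) by blast
  \<comment> \<open>A missing vertex nearest to \<open>v\<close> has its predecessor on the tour
    already, since that predecessor is nearer to \<open>v\<close>.\<close>
  then obtain y where y: "y \<in> pverts G - ?S"
    and min: "\<And>z. z \<in> pverts G - ?S \<Longrightarrow> graph_dist G v y \<le> graph_dist G v z"
    using ex_has_least_nat[of "\<lambda>z. z \<in> pverts G - ?S" z "graph_dist G v"] by blast
  then have "graph_dist G v y \<noteq> 0" using graph_dist_eq_0[of v y] assms by auto
  then obtain k where k: "graph_dist G v y = Suc k" by (cases "graph_dist G v y") auto
  then obtain x where x: "x \<in> pverts G" "(x, y) \<in> parcs G" "graph_dist G v x = k"
    using graph_dist_pred[of v y] assms y by blast
  then have "x \<in> ?S" using min[of x] k by auto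
  then obtain as bs where ab: "v # zs = as @ x # bs" by (meson split_list)
  \<comment> \<open>Placing \<open>y\<close> behind \<open>x\<close> keeps \<open>v\<close> at the
    head, even if \<open>x\<close> is \<open>v\<close> itself.\<close>
  then obtain zs' where zs': "v # zs' = as @ x # y # bs" by (cases as) auto
  have "set bs \<subseteq> pverts G" using zs(2) unfolding ab by auto
  then have "tour_length (graph_dist G) (v # zs' @ [v]) \<le> tour_length (graph_dist G) (v # zs @ [v]) + 2"
    using tour_length_insert[OF x(2), of "bs @ [v]" as] assms(1)
    unfolding append_Cons[symmetric] ab zs' by simp
  moreover have "distinct (v # zs')" "set (v # zs') = insert y ?S" "length (v # zs') = Suc (length (v # zs))"
    using zs(1) y unfolding ab zs' by auto
  ultimately show ?case using zs y by (intro exI[of _ zs']) auto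
qed

lemma sum_le_closed_tour:
  assumes W: "W \<subseteq> pverts G" "card W \<ge> 2"
    and g: "\<And>u v. u \<in> W \<Longrightarrow> v \<in> W \<Longrightarrow> u \<noteq> v \<Longrightarrow> g v \<le> graph_dist G u v"
  shows "sum g W \<le> 2 * (card (pverts G) - 1)"
proof -
  have "W \<noteq> {}" using W(2) by auto
  then obtain v where v: "v \<in> W" "v \<in> pverts G" using W(1) by blast
  let ?D = "tour_length (graph_dist G)" and ?n = "card (pverts G)"
  have n: "?n > 0" using v(2) by (simp add: card_gt_0_iff) blast
  then obtain zs where zs: "distinct (v # zs)" "set (v # zs) \<subseteq> pverts G" "length zs = ?n - 1"
    "?D (v # zs @ [v]) \<le> 2 * (?n - 1)"
    using closed_tour_of_card[OF v(2), of "?n - 1"] by auto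
  have "card (set (v # zs)) = ?n" using distinct_card[OF zs(1)] zs(3) n by simp
  then have all: "set (v # zs) = pverts G" using zs(2) by (intro card_subset_eq) auto
  define ys where "ys = filter (\<lambda>z. z \<in> W) zs"
  have ys: "distinct (v # ys)" "set (v # ys) = W" using zs(1) all W v by (auto simp: ys_def)
  \<comment> \<open>Two elements of \<open>W\<close> are needed for the closing step to join
    distinct vertices and thus pay for \<open>g v\<close>.\<close>
  then have "ys \<noteq> []" using W(2) by auto
  then have last: "last (v # ys) \<in> set ys" by simp
  have "sum g W = sum_list (map g ys) + g v"
    using sum_list_distinct_conv_sum_set[OF ys(1), of g] ys(2) by simp
  also have "\<dots> \<le> ?D (v # ys) + graph_dist G (last (v # ys)) v"
    using last ys g v by (intro add_mono sum_list_le_tour_length g) auto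
  \<comment> \<open>As \<open>v\<close> is in \<open>W\<close>, the filter keeps the final
    \<open>v\<close>: the closed tour through \<open>W\<close> is a shortcut of the one through all
    vertices.\<close>
  also have "\<dots> = ?D (v # filter (\<lambda>z. z \<in> W) (zs @ [v]))"
    using tour_length_append[of "v # ys" "[v]" "graph_dist G"] v by (simp add: ys_def)
  also have "\<dots> \<le> ?D (v # zs @ [v])"
    using zs(2) by (intro tour_length_filter) auto
  finally show ?thesis using zs(4) by simp
qed

lemma weight_le_if_not_path:
  assumes np: "\<not> is_path G" and bf: "broadcast G f" and hf: "h_independent G f"
  shows "weight G f + 5 \<le> 2 * card (pverts G)"
proof -
  let ?n = "card (pverts G)" and ?W = "broadcasting G f"
  have dist: "graph_dist G u v + 2 \<le> ?n" if "u \<in> pverts G" "v \<in> pverts G" for u v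
    using is_path_if_graph_dist_ge[OF that] np by fastforce
  have W: "?W \<subseteq> pverts G" by (auto simp: broadcasting_def)
  then have finW: "finite ?W" using finite_subset by fastforce
  obtain u where u: "u \<in> pverts G"
    using connected_G by (auto simp: connected_def strongly_connected_def)
  \<comment> \<open>The distance bound for \<open>u\<close> and itself yields a second vertex; its
    positive distance from \<open>u\<close> yields a third.\<close>
  have n3: "?n \<ge> 3"
  proof -
    have "?n \<ge> 2" using dist[OF u u] by simp
    then obtain v where v: "v \<in> pverts G" "v \<noteq> u"
      by (metis One_nat_def Suc_1 card_le_Suc0_iff_eq finite_verts not_less_eq_eq u with_proj_simps(1))
    then show ?thesis using dist[OF u v(1)] graph_dist_eq_0[OF u v(1)] by fastforce
  qed
  have far: "f v + 1 \<le> graph_dist G u v" if "u \<in> ?W" "v \<in> ?W" "u \<noteq> v" for u v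
    using hf that W by (fastforce simp: h_independent_def hears_def)
  have wt: "weight G f = sum f ?W"
    unfolding weight_def broadcasting_def by (rule sum.mono_neutral_right) auto
  consider "card ?W = 0" | "card ?W = 1" | "card ?W = 2" | "card ?W \<ge> 3" by linarith
  then show ?thesis
  proof cases
    case 1
    then show ?thesis using wt finW n3 by simp
  next
    case 2
    then obtain v where v: "?W = {v}" by (auto simp: card_1_singleton_iff)
    then have "v \<in> pverts G" using W by auto
    \<comment> \<open>The eccentricity is an attained distance, hence at most
      \<open>?n - 2\<close>.\<close>
    then have "eccentricity G v + 2 \<le> ?n"
      using dist Max_in[of "graph_dist G v ` pverts G"] u unfolding eccentricity_def by fastforce
    then have "f v + 2 \<le> ?n" using bf \<open>v \<in> pverts G\<close> by (fastforce simp: broadcast_def)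
    then show ?thesis using wt v n3 by simp
  next
    case 3
    then obtain v w where vw: "?W = {v, w}" "v \<noteq> w" by (auto simp: card_2_iff)
    then have "v \<in> pverts G" "w \<in> pverts G" using W by auto
    \<comment> \<open>Both values are below the distance of \<open>v\<close> and \<open>w\<close>,
      hence at most \<open>?n - 3\<close>.\<close>
    then show ?thesis
      using wt vw far[of v w] far[of w v] dist[of v w] dist[of w v] by simp
  next
    case 4
    \<comment> \<open>The extra 1 per vertex adds \<open>card ?W\<close> to the weight; together
      with the 2 from \<open>2 * (?n - 1)\<close> this gives at least 5.\<close>
    have "sum (\<lambda>v. f v + 1) ?W \<le> 2 * (?n - 1)"
      using 4 far by (intro sum_le_closed_tour[OF W]) auto
    then show ?thesis using wt 4 n3 by (simp add: sum.distrib del: One_nat_def)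
  qed
qed

end

theorem corollary3p5:
  fixes G :: "'a pair_pre_digraph" and n :: nat
  assumes "pair_graph G"
    and "connected (with_proj G)"
    and "card (pverts G) = n"
    and "\<not> is_path G"
  shows "int (alpha_h G) \<le> 2 * int n - 5"
proof -
  interpret connected_pair_graph G
    using assms(1,2) by (intro connected_pair_graph.intro connected_pair_graph_axioms.intro)
  \<comment> \<open>The maximum is attained, so it suffices to bound the weight of a single
    broadcast.\<close>
  have "alpha_h G \<in> {weight G f | f. broadcast G f \<and> h_independent G f}"
    unfolding alpha_h_def
    by (intro Max_in finite_h_independent_weights h_independent_weights_nonempty) simp
  then have "alpha_h G + 5 \<le> 2 * n" using weight_le_if_not_path assms(3,4) by auto
  then show ?thesis by linarith
qed

end
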